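(* Let $C(E)=E^b$ with $b\in\mathbb R$, $b\ge1$. Then $$C_{max}(a,d,e)\ \ge\ \left(\frac{l_{min}\sum_{j\in J}e_j}{2\,l_{min}+a_n-a_1}\right)^b .$$
   Context: Total-energy model, full attack. Time is slotted with slots $1,\dots,T$; $[k,l]$ denotes the set of slots $\{k,\dots,l\}$. There are $n\ge1$ jobs $J=\{1,\dots,n\}$; job $j$ has demand $(a_j,d_j,e_j)$ with $a_j,d_j\in\{1,\dots,T\}$, $a_j\le d_j$, $e_j>0$ (arrival slot, deadline slot, total energy). Jobs are sorted by arrival time, $a_1\le a_2\le\dots\le a_n$. The job allowance is $l_j=d_j-a_j+1$, and $l_{min}=\min_{j\in J}l_j$. Optimal offline full attack cost: each job $j$ is served entirely in one slot $t_j\in[a_j,d_j]$, and $$C_{max}(a,d,e)=\max_{t_j\in[a_j,d_j],\,j\in J}\ \sum_{t=1}^T C\Big(\sum_{j\in J:\,t_j=t}e_j\Big).$$ *)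

theory Defs
  imports Complex_Main "HOL-Library.FuncSet"
begin

text \<open>
  The jobs are \<open>{1..n}\<close> and the slots \<open>{1..T}\<close>; job \<open>j\<close> has arrival slot \<open>a j\<close>,
  deadline slot \<open>d j\<close> and total energy \<open>e j\<close>.
\<close>

definition job_instance ::
  "nat \<Rightarrow> nat \<Rightarrow> (nat \<Rightarrow> nat) \<Rightarrow> (nat \<Rightarrow> nat) \<Rightarrow> (nat \<Rightarrow> real) \<Rightarrow> bool" where
  "job_instance T n a d e \<longleftrightarrow>
     n \<ge> 1 \<and>
     (\<forall>j\<in>{1..n}. a j \<in> {1..T} \<and> d j \<in> {1..T} \<and> a j \<le> d j \<and> e j > 0) \<and>
     (\<forall>i\<in>{1..n}. \<forall>j\<in>{1..n}. i \<le> j \<longrightarrow> a i \<le> a j)"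

definition allowance :: "(nat \<Rightarrow> nat) \<Rightarrow> (nat \<Rightarrow> nat) \<Rightarrow> nat \<Rightarrow> nat" where
  "allowance a d j = d j - a j + 1"

definition l_min :: "nat \<Rightarrow> (nat \<Rightarrow> nat) \<Rightarrow> (nat \<Rightarrow> nat) \<Rightarrow> nat" where
  "l_min n a d = Min (allowance a d ` {1..n})"

text \<open>
  Serving each job entirely in one slot is a map from jobs to slots; extensionality outside
  \<open>{1..n}\<close> makes the set of such maps finite, so that the maximum below is attained.
\<close>

definition schedules :: "nat \<Rightarrow> (nat \<Rightarrow> nat) \<Rightarrow> (nat \<Rightarrow> nat) \<Rightarrow> (nat \<Rightarrow> nat) set" where
  "schedules n a d = (\<Pi>\<^sub>E j\<in>{1..n}. {a j..d j})"

definition schedule_cost ::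
  "(real \<Rightarrow> real) \<Rightarrow> nat \<Rightarrow> nat \<Rightarrow> (nat \<Rightarrow> real) \<Rightarrow> (nat \<Rightarrow> nat) \<Rightarrow> real" where
  "schedule_cost C T n e s = (\<Sum>t=1..T. C (\<Sum>j\<in>{j\<in>{1..n}. s j = t}. e j))"

definition C_max ::
  "(real \<Rightarrow> real) \<Rightarrow> nat \<Rightarrow> nat \<Rightarrow> (nat \<Rightarrow> nat) \<Rightarrow> (nat \<Rightarrow> nat) \<Rightarrow> (nat \<Rightarrow> real) \<Rightarrow> real" where
  "C_max C T n a d e = Max (schedule_cost C T n e ` schedules n a d)"

end

theory Submission
  imports Defs
begin

text \<open>
  Cut the arrival range \<open>[a\<^sub>1, a\<^sub>n]\<close> into windows of length \<open>l\<^sub>m\<^sub>i\<^sub>n\<close> and serve every job in the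
  last slot of the window in which it arrives; this meets every deadline, since no allowance is
  below \<open>l\<^sub>m\<^sub>i\<^sub>n\<close>. There are at most \<open>(a\<^sub>n - a\<^sub>1) / l\<^sub>m\<^sub>i\<^sub>n + 1\<close> windows, so by pigeonhole some slot
  carries at least \<open>l\<^sub>m\<^sub>i\<^sub>n \<Sum> e\<^sub>j / (l\<^sub>m\<^sub>i\<^sub>n + a\<^sub>n - a\<^sub>1)\<close> energy, and the cost of this slot alone suffices.
\<close>

text \<open>The fibres of \<open>s\<close> partition \<open>A\<close>; if \<open>m\<close> times
  each fibre sum fell short of the total, adding over at most \<open>m\<close> fibres would put
  \<open>m\<close> times the total below itself. Only a bound \<open>m\<close> on the number of
  fibres is asked for, so the sign of \<open>e\<close> matters when \<open>m\<close> replaces the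
  cardinality.\<close>

lemma sum_fibre_pigeonhole:
  fixes e :: "'a \<Rightarrow> real"
  assumes "finite A" "A \<noteq> {}" "card (s ` A) \<le> m" "\<And>j. j \<in> A \<Longrightarrow> e j \<ge> 0"
  shows "\<exists>t\<in>s ` A. sum e A \<le> real m * sum e {j \<in> A. s j = t}"
proof (rule ccontr)
  assume "\<not> ?thesis"
  then have small: "real m * sum e {j \<in> A. s j = t} < sum e A" if "t \<in> s ` A" for t
    using that by force
  \<comment> \<open>The strict inequality survives summation only over a nonempty index set.\<close>
  have "card (s ` A) > 0"
    using assms(1,2) by (simp add: card_gt_0_iff)
  have "real m * sum e A = (\<Sum>t\<in>s ` A. real m * sum e {j \<in> A. s j = t})"
    using sum.image_gen[OF assms(1), of e s] by (simp add: sum_distrib_left)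
  also have "\<dots> < real (card (s ` A)) * sum e A"
    using sum_bounded_above_strict[OF small \<open>card (s ` A) > 0\<close>] by simp
  also have "\<dots> \<le> real m * sum e A"
    using assms(3,4) by (intro mult_right_mono sum_nonneg) auto
  finally show False by simp
qed

lemma schedule_cost_le_C_max:
  assumes "s \<in> schedules n a d"
  shows "schedule_cost C T n e s \<le> C_max C T n a d e"
proof -
  have "finite (schedules n a d)"
    unfolding schedules_def by (intro finite_PiE) auto
  then show ?thesis
    using assms unfolding C_max_def by (intro Max_ge) auto
qed

lemma slot_cost_le_schedule_cost:
  assumes "\<And>E. C E \<ge> 0" "t \<in> {1..T}"
  shows "C (\<Sum>j\<in>{j\<in>{1..n}. s j = t}. e j) \<le> schedule_cost C T n e s"
  unfolding schedule_cost_def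
  using assms by (intro member_le_sum) auto

text \<open>For an arrival at offset \<open>x\<close> from \<open>a 1\<close>, these place the last
  slot of its window between \<open>x\<close> and \<open>x + (l - 1)\<close>.\<close>

lemma window_end_bounds:
  fixes l x :: nat
  assumes "l > 0"
  shows "x \<le> x div l * l + (l - 1)" "x div l * l \<le> x"
proof -
  have "x mod l < l"
    using assms by simp
  then show "x \<le> x div l * l + (l - 1)"
    using div_mult_mod_eq[of x l] by linarith
qed simp

text \<open>The factor contains a single \<open>l\<close>, which is sharper than the denominator of
  the theorem; the product form avoids division.\<close>

lemma exists_heavy_slot:
  assumes inst: "job_instance T n a d e"
  defines "l \<equiv> l_min n a d"
  shows "l > 0"
    and "\<exists>s\<in>schedules n a d. \<exists>t\<in>{1..T}. real l * (\<Sum>j=1..n. e j)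
           \<le> (real l + real (a n) - real (a 1)) * (\<Sum>j\<in>{j\<in>{1..n}. s j = t}. e j)"
proof -
  have "n \<ge> 1"
    and job: "\<And>j. j \<in> {1..n} \<Longrightarrow> a j \<le> d j \<and> d j \<le> T \<and> 1 \<le> a j \<and> e j > 0"
    and mono: "\<And>i j. \<lbrakk>i \<in> {1..n}; j \<in> {1..n}; i \<le> j\<rbrakk> \<Longrightarrow> a i \<le> a j"
    using inst unfolding job_instance_def by auto
  then have ne: "{1..n} \<noteq> {}" by simp
  have l_le: "l \<le> d j - a j + 1" if "j \<in> {1..n}" for j
    using that unfolding l_def l_min_def allowance_def by (intro Min_le) auto
  show "l > 0"
    using ne unfolding l_def l_min_def allowance_def by (subst Min_gr_iff) auto
  \<comment> \<open>Windows are numbered from 0, starting at \<open>a 1\<close>. In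
    \<open>s\<close>, \<open>restrict\<close> supplies the extensionality that
    \<open>schedules\<close> demands.\<close>
  define k where "k = (\<lambda>j. (a j - a 1) div l)"
  define s where "s = restrict (\<lambda>j. a 1 + (k j * l + (l - 1))) {1..n}"
  have range: "a 1 \<le> a j" "a j \<le> a n" if "j \<in> {1..n}" for j
    using that mono[of 1 j] mono[of j n] by auto
  have s_in: "s j \<in> {a j..d j}" if "j \<in> {1..n}" for j
  proof -
    have "s j = a 1 + ((a j - a 1) div l * l + (l - 1))"
      using that by (simp add: s_def k_def)
    \<comment> \<open>The delay \<open>s j - a j\<close> is at most \<open>l - 1\<close>, hence at
      most \<open>d j - a j\<close>.\<close>
    then have "a j \<le> s j" "s j \<le> d j"
      using window_end_bounds[OF \<open>l > 0\<close>, of "a j - a 1"] range[OF that] l_le[OF that] job[OF that]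
      by linarith+
    then show ?thesis by simp
  qed
  then have "s \<in> schedules n a d"
    unfolding schedules_def s_def by (intro PiE_I) auto
  define m where "m = (a n - a 1) div l + 1"
  \<comment> \<open>Each slot in use is the end of a window with index below \<open>m\<close>, so at
    most \<open>m\<close> slots are used.\<close>
  have "s ` {1..n} \<subseteq> (\<lambda>i. a 1 + (i * l + (l - 1))) ` {..<m}"
  proof
    fix t assume "t \<in> s ` {1..n}"
    then obtain j where j: "j \<in> {1..n}" "t = s j" by blast
    have "k j < m"
      unfolding k_def m_def using range[OF j(1)] by (simp add: div_le_mono less_Suc_eq_le)
    with j show "t \<in> (\<lambda>i. a 1 + (i * l + (l - 1))) ` {..<m}"
      by (auto simp: s_def)
  qed
  then have card: "card (s ` {1..n}) \<le> m"
    by (metis card_lessThan finite_lessThan surj_card_le)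
  obtain t where t: "t \<in> s ` {1..n}"
    "(\<Sum>j=1..n. e j) \<le> real m * (\<Sum>j\<in>{j\<in>{1..n}. s j = t}. e j)"
    using sum_fibre_pigeonhole[OF _ ne card, of e] job by (force intro: less_imp_le)
  \<comment> \<open>Rounding down in \<open>div\<close> costs nothing here: \<open>l\<close> times
    the quotient is at most \<open>a n - a 1\<close>.\<close>
  have "l * m \<le> l + (a n - a 1)"
    by (simp add: m_def)
  then have lm: "real l * real m \<le> real l + real (a n) - real (a 1)"
    using range(1)[of n] \<open>n \<ge> 1\<close>
    by (simp add: of_nat_diff flip: of_nat_mult of_nat_add)
  have nonneg: "0 \<le> (\<Sum>j\<in>{j\<in>{1..n}. s j = t}. e j)"
    using job by (intro sum_nonneg) (auto intro: less_imp_le)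
  have "real l * (\<Sum>j=1..n. e j) \<le> real l * real m * (\<Sum>j\<in>{j\<in>{1..n}. s j = t}. e j)"
    using mult_left_mono[OF t(2), of "real l"] by (simp add: mult.assoc)
  also have "\<dots> \<le> (real l + real (a n) - real (a 1)) * (\<Sum>j\<in>{j\<in>{1..n}. s j = t}. e j)"
    by (rule mult_right_mono[OF lm nonneg])
  finally have heavy: "real l * (\<Sum>j=1..n. e j)
    \<le> (real l + real (a n) - real (a 1)) * (\<Sum>j\<in>{j\<in>{1..n}. s j = t}. e j)" .
  \<comment> \<open>The last window may end after \<open>a n\<close>, but \<open>t\<close> is the
    slot of some job and so is bounded by its deadline.\<close>
  have "t \<in> {1..T}"
    using t(1) s_in job by fastforce
  with heavy \<open>s \<in> schedules n a d\<close> show "\<exists>s\<in>schedules n a d. \<exists>t\<in>{1..T}. real l * (\<Sum>j=1..n. e j)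
      \<le> (real l + real (a n) - real (a 1)) * (\<Sum>j\<in>{j\<in>{1..n}. s j = t}. e j)"
    by blast
qed

theorem theorem3:
  fixes T n :: nat and a d :: "nat \<Rightarrow> nat" and e :: "nat \<Rightarrow> real" and b :: real
  assumes "job_instance T n a d e"
    and "b \<ge> 1"
  shows "C_max (\<lambda>E. E powr b) T n a d e \<ge>
    ((real (l_min n a d) * (\<Sum>j=1..n. e j)) /
      (2 * real (l_min n a d) + real (a n) - real (a 1))) powr b"
proof -
  let ?l = "real (l_min n a d)"
  have e_pos: "\<And>j. j \<in> {1..n} \<Longrightarrow> e j > 0" and "a 1 \<le> a n"
    using assms(1) unfolding job_instance_def by auto
  have "?l > 0"
    using exists_heavy_slot(1)[OF assms(1)] by simp
  obtain s t where s: "s \<in> schedules n a d" and t: "t \<in> {1..T}" and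
    heavy: "?l * (\<Sum>j=1..n. e j)
      \<le> (?l + real (a n) - real (a 1)) * (\<Sum>j\<in>{j\<in>{1..n}. s j = t}. e j)"
    using exists_heavy_slot(2)[OF assms(1)] by blast
  have "0 \<le> (\<Sum>j\<in>{j\<in>{1..n}. s j = t}. e j)"
    using e_pos by (intro sum_nonneg) (auto intro: less_imp_le)
  \<comment> \<open>The bound is relaxed from \<open>l\<close> to \<open>2 * l\<close> in the
    factor, as the slot's load is nonnegative.\<close>
  then have "(?l + real (a n) - real (a 1)) * (\<Sum>j\<in>{j\<in>{1..n}. s j = t}. e j)
    \<le> (2 * ?l + real (a n) - real (a 1)) * (\<Sum>j\<in>{j\<in>{1..n}. s j = t}. e j)"
    by (intro mult_right_mono) auto
  with heavy have "?l * (\<Sum>j=1..n. e j) / (2 * ?l + real (a n) - real (a 1))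
    \<le> (\<Sum>j\<in>{j\<in>{1..n}. s j = t}. e j)"
    using \<open>?l > 0\<close> \<open>a 1 \<le> a n\<close> by (subst pos_divide_le_eq) (auto simp: mult.commute)
  moreover have "0 \<le> ?l * (\<Sum>j=1..n. e j) / (2 * ?l + real (a n) - real (a 1))"
    using e_pos \<open>a 1 \<le> a n\<close>
    by (intro divide_nonneg_nonneg mult_nonneg_nonneg sum_nonneg) (auto intro: less_imp_le)
  ultimately have "(?l * (\<Sum>j=1..n. e j) / (2 * ?l + real (a n) - real (a 1))) powr b
    \<le> (\<Sum>j\<in>{j\<in>{1..n}. s j = t}. e j) powr b"
    using assms(2) by (intro powr_mono2) auto
  \<comment> \<open>Since \<open>powr\<close> is never negative, the other slots can only add to the
    cost.\<close>
  also have "\<dots> \<le> schedule_cost (\<lambda>E. E powr b) T n e s"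
    using slot_cost_le_schedule_cost[of "\<lambda>E. E powr b", OF _ t] by simp
  also have "\<dots> \<le> C_max (\<lambda>E. E powr b) T n a d e"
    by (rule schedule_cost_le_C_max[OF s])
  finally show ?thesis .
qed

end
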